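(* Let $n$ be a positive integer, let $D\subset M_n(\mathbb{C})$ be the algebra of diagonal matrices, let $\tau=\frac1n\mathrm{Tr}$, and let $U=\frac{1}{\sqrt n}\left(\epsilon^{(i-1)(j-1)}\right)_{1\le i,j\le n}$ with $\epsilon=\cos\frac{2\pi}{n}+i\sin\frac{2\pi}{n}$ (the standard biunitary of order $n$). Then the commuting square $$\left(\begin{matrix} D & \subset & M_n(\mathbb{C})\\ \cup & & \cup\\ \mathbb{C} & \subset & U^*DU\end{matrix},\tau\right)$$ satisfies the span condition if and only if $n$ is prime.
   Context: For a commuting square with finite dimensional von Neumann algebras $Q_{-1}\subset P_{-1}\subset P_0$, $Q_{-1}\subset Q_0\subset P_0$ and faithful positive normalized trace $\tau$ on $P_0$ (i.e. $E_{P_{-1}}E_{Q_0}=E_{Q_{-1}}$, where $E_A$ is the $\tau$-invariant conditional expectation of $P_0$ onto $A$), the span condition is $$[P_{-1},Q_0]+(Q_{-1}'\cap P_{-1})+(Q_{-1}'\cap Q_0)+(P_{-1}'\cap P_0)+(Q_0'\cap P_0)=P_0,$$ where $B'\cap A=\{a\in A: ab=ba\ \forall b\in B\}$, $V+W=\{v+w: v\in V,w\in W\}$ and $[V,W]=\mathrm{span}\{vw-wv: v\in V,w\in W\}$. Here $P_0=M_n(\mathbb{C})$, $P_{-1}=D$, $Q_0=U^*DU$, $Q_{-1}=\mathbb{C}I$.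
   Formalization: The formal theorem assumes n ≥ 2 instead of n positive: for n = 1 all four algebras equal ℂ, so the span condition holds although 1 is not prime and the claimed equivalence fails. *)

theory Defs
  imports
    "Jordan_Normal_Form.Schur_Decomposition"
    "HOL-Library.Set_Algebras"
    "HOL-Computational_Algebra.Primes"
begin

(* A von Neumann algebra acting on C^n. The dimension is finite, so no closure
   condition is needed. All inclusions between such algebras are unital. *)
definition vN_algebra :: "nat \<Rightarrow> complex mat set \<Rightarrow> bool" where
  "vN_algebra n A \<longleftrightarrow>
     A \<subseteq> carrier_mat n n \<and> 1\<^sub>m n \<in> A \<and>
     (\<forall>x\<in>A. \<forall>y\<in>A. x + y \<in> A) \<and>
     (\<forall>c. \<forall>x\<in>A. c \<cdot>\<^sub>m x \<in> A) \<and>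
     (\<forall>x\<in>A. \<forall>y\<in>A. x * y \<in> A) \<and>
     (\<forall>x\<in>A. mat_adjoint x \<in> A)"

(* The order on complex numbers is the one in which 0 \<le> z means that z is
   real and nonnegative. *)
definition faithful_normalized_trace ::
    "nat \<Rightarrow> complex mat set \<Rightarrow> (complex mat \<Rightarrow> complex) \<Rightarrow> bool" where
  "faithful_normalized_trace n P \<tau> \<longleftrightarrow>
     (\<forall>x\<in>P. \<forall>y\<in>P. \<tau> (x + y) = \<tau> x + \<tau> y) \<and>
     (\<forall>c. \<forall>x\<in>P. \<tau> (c \<cdot>\<^sub>m x) = c * \<tau> x) \<and>
     (\<forall>x\<in>P. \<forall>y\<in>P. \<tau> (x * y) = \<tau> (y * x)) \<and>
     \<tau> (1\<^sub>m n) = 1 \<and>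
     (\<forall>x\<in>P. 0 \<le> \<tau> (mat_adjoint x * x)) \<and>
     (\<forall>x\<in>P. \<tau> (mat_adjoint x * x) = 0 \<longrightarrow> x = 0\<^sub>m n n)"

(* E is a \<tau>-invariant conditional expectation of P onto A: a positive linear
   A-bimodule projection of P onto A with \<tau> o E = \<tau>. *)
definition is_cond_exp ::
    "(complex mat \<Rightarrow> complex) \<Rightarrow> complex mat set \<Rightarrow> complex mat set \<Rightarrow>
     (complex mat \<Rightarrow> complex mat) \<Rightarrow> bool" where
  "is_cond_exp \<tau> P A E \<longleftrightarrow>
     (\<forall>x\<in>P. E x \<in> A) \<and>
     (\<forall>a\<in>A. E a = a) \<and>
     (\<forall>x\<in>P. \<forall>y\<in>P. E (x + y) = E x + E y) \<and>
     (\<forall>c. \<forall>x\<in>P. E (c \<cdot>\<^sub>m x) = c \<cdot>\<^sub>m E x) \<and>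
     (\<forall>x\<in>P. \<exists>y\<in>A. E (mat_adjoint x * x) = mat_adjoint y * y) \<and>
     (\<forall>a\<in>A. \<forall>b\<in>A. \<forall>x\<in>P. E (a * x * b) = a * E x * b) \<and>
     (\<forall>x\<in>P. \<tau> (E x) = \<tau> x)"

(* The arguments after \<tau> are Q_{-1}, P_{-1}, Q_0, P_0. For a faithful trace the
   \<tau>-invariant conditional expectation onto a given subalgebra is unique, so
   the existential quantifiers below only name the three expectations. *)
definition commuting_square ::
    "nat \<Rightarrow> (complex mat \<Rightarrow> complex) \<Rightarrow> complex mat set \<Rightarrow> complex mat set \<Rightarrow>
     complex mat set \<Rightarrow> complex mat set \<Rightarrow> bool" where
  "commuting_square n \<tau> Q1 P1 Q0 P0 \<longleftrightarrow>
     vN_algebra n Q1 \<and> vN_algebra n P1 \<and> vN_algebra n Q0 \<and> vN_algebra n P0 \<and>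
     Q1 \<subseteq> P1 \<and> P1 \<subseteq> P0 \<and> Q1 \<subseteq> Q0 \<and> Q0 \<subseteq> P0 \<and>
     faithful_normalized_trace n P0 \<tau> \<and>
     (\<exists>E_P1 E_Q0 E_Q1.
        is_cond_exp \<tau> P0 P1 E_P1 \<and> is_cond_exp \<tau> P0 Q0 E_Q0 \<and>
        is_cond_exp \<tau> P0 Q1 E_Q1 \<and> (\<forall>x\<in>P0. E_P1 (E_Q0 x) = E_Q1 x))"

(* rel_commutant B A is B' \<inter> A. *)
definition rel_commutant :: "complex mat set \<Rightarrow> complex mat set \<Rightarrow> complex mat set" where
  "rel_commutant B A = {a \<in> A. \<forall>b\<in>B. a * b = b * a}"

(* [V, W], with the span taken in the complex vector space M_n(C). *)
definition commutator_span ::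
    "nat \<Rightarrow> complex mat set \<Rightarrow> complex mat set \<Rightarrow> complex mat set" where
  "commutator_span n V W =
     LinearCombinations.module.span class_ring (module_mat TYPE(complex) n n)
       {v * w - w * v | v w. v \<in> V \<and> w \<in> W}"

definition span_condition ::
    "nat \<Rightarrow> complex mat set \<Rightarrow> complex mat set \<Rightarrow> complex mat set \<Rightarrow>
     complex mat set \<Rightarrow> bool" where
  "span_condition n Q1 P1 Q0 P0 \<longleftrightarrow>
     commutator_span n P1 Q0 + rel_commutant Q1 P1 + rel_commutant Q1 Q0
       + rel_commutant P1 P0 + rel_commutant Q0 P0 = P0"

definition diagonal_algebra :: "nat \<Rightarrow> complex mat set" where
  "diagonal_algebra n = {A \<in> carrier_mat n n. diagonal_mat A}"

definition scalar_algebra :: "nat \<Rightarrow> complex mat set" where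
  "scalar_algebra n = {c \<cdot>\<^sub>m 1\<^sub>m n | c. True}"

definition normalized_trace :: "nat \<Rightarrow> complex mat \<Rightarrow> complex" where
  "normalized_trace n A = (1 / of_nat n) * (\<Sum>i<n. A $$ (i, i))"

(* Matrix indices start at 0, hence the exponent i * j. *)
definition standard_biunitary :: "nat \<Rightarrow> complex mat" where
  "standard_biunitary n =
     (let \<epsilon> = complex_of_real (cos (2 * pi / real n)) + \<i> * complex_of_real (sin (2 * pi / real n))
      in complex_of_real (1 / sqrt (real n)) \<cdot>\<^sub>m mat n n (\<lambda>(i, j). \<epsilon> ^ (i * j)))"

definition conjugate_algebra :: "complex mat \<Rightarrow> complex mat set \<Rightarrow> complex mat set" where
  "conjugate_algebra U A = {mat_adjoint U * d * U | d. d \<in> A}"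

(* In order 1 all four algebras are C and the span condition holds, although 1
   is not prime. *)
lemma span_condition_order_1:
  "span_condition 1 (scalar_algebra 1) (diagonal_algebra 1)
     (conjugate_algebra (standard_biunitary 1) (diagonal_algebra 1)) (carrier_mat 1 1)"
  (is "span_condition 1 ?Q1 ?P1 ?Q0 ?P0")
proof -
  have U: "standard_biunitary 1 \<in> ?P0"
    by (auto simp: standard_biunitary_def Let_def)
  have adj: "mat_adjoint A \<in> ?P0" if "A \<in> ?P0" for A :: "complex mat"
    using that by (auto simp: mat_adjoint_def)
  have comm: "A * B = B * A" if "A \<in> ?P0" "B \<in> ?P0" for A B :: "complex mat"
    using that by (intro eq_matI) (auto simp: scalar_prod_def)
  have P1: "?P1 = ?P0" by (auto simp: diagonal_algebra_def diagonal_mat_def)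
  have Q0: "?Q0 \<subseteq> ?P0" unfolding conjugate_algebra_def P1 using U adj[OF U] by auto
  have Q1: "?Q1 \<subseteq> ?P0" by (auto simp: scalar_algebra_def)
  have zQ0: "0\<^sub>m 1 1 \<in> ?Q0"
    unfolding conjugate_algebra_def P1 using U adj[OF U]
    by (auto intro!: exI[of _ "0\<^sub>m 1 1"])
  interpret V: vectorspace "class_ring :: complex ring" "module_mat TYPE(complex) 1 1"
    by (rule matrix_vs)
  have "span_condition 1 Q1 ?P0 Q0 ?P0"
    if Q0: "Q0 \<subseteq> ?P0" and Q1: "Q1 \<subseteq> ?P0" and zQ0: "0\<^sub>m 1 1 \<in> Q0" for Q0 Q1
  proof -
    have gen: "{v * w - w * v | v w. v \<in> ?P0 \<and> w \<in> Q0} \<subseteq> carrier (module_mat TYPE(complex) 1 1)"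
    proof
      fix x assume "x \<in> {v * w - w * v | v w. v \<in> ?P0 \<and> w \<in> Q0}"
      then obtain v w where x: "x = v * w - w * v" and v: "v \<in> ?P0" and w: "w \<in> ?P0"
        using Q0 by blast
      show "x \<in> carrier (module_mat TYPE(complex) 1 1)"
        unfolding x module_mat_simps by (rule minus_carrier_mat[OF mult_carrier_mat[OF w v]])
    qed
    have S: "commutator_span 1 ?P0 Q0 \<subseteq> ?P0"
      using V.span_is_subset2[OF gen] unfolding commutator_span_def module_mat_simps .
    have zS: "0\<^sub>m 1 1 \<in> commutator_span 1 ?P0 Q0"
      using submodule.zero_closed[OF V.span_is_submodule[OF gen]] unfolding commutator_span_def module_mat_simps .
    have C: "rel_commutant B A = A" if "B \<subseteq> ?P0" "A \<subseteq> ?P0" for A B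
      using that comm unfolding rel_commutant_def by blast
    have add: "X + Y \<subseteq> ?P0" if "X \<subseteq> ?P0" "Y \<subseteq> ?P0" for X Y
      using that by (auto simp: set_plus_def)
    have abs: "Y \<subseteq> X + Y" if "0\<^sub>m 1 1 \<in> X" "Y \<subseteq> ?P0" for X Y
    proof
      fix y assume y: "y \<in> Y"
      then have "0\<^sub>m 1 1 + y = y" using that(2) by (intro left_add_zero_mat) blast
      then show "y \<in> X + Y" using set_plus_intro[OF that(1) y] by simp
    qed
    have z: "0\<^sub>m 1 1 \<in> X + Y" if "0\<^sub>m 1 1 \<in> X" "0\<^sub>m 1 1 \<in> Y" "Y \<subseteq> ?P0" for X Y
      using abs[OF that(1,3)] that(2) by blast
    let ?R = "commutator_span 1 ?P0 Q0 + ?P0 + Q0 + ?P0"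
    have "0\<^sub>m 1 1 \<in> ?R"
      by (intro z zS zQ0 Q0 zero_carrier_mat subset_refl)
    then have ge: "?P0 \<subseteq> ?R + ?P0" by (rule abs) (rule subset_refl)
    have le: "?R + ?P0 \<subseteq> ?P0"
      by (intro add S Q0 subset_refl)
    show ?thesis
      unfolding span_condition_def C[OF Q1 subset_refl] C[OF Q1 Q0]
        C[OF subset_refl subset_refl] C[OF Q0 subset_refl]
      using le ge by (rule subset_antisym)
  qed
  from this[OF Q0 Q1 zQ0] show ?thesis by (simp only: P1)
qed

end

theory Submission
  imports Defs "HOL-Number_Theory.Cong"
begin

text \<open>
  The algebra \<open>U\<^sup>*DU\<close> consists of the circulant matrices, and \<open>D\<close> and \<open>U\<^sup>*DU\<close> are their own
  commutants in \<open>M\<^sub>n(\<complex>)\<close>. The commutator of a diagonal matrix \<open>d\<close> with the \<open>b\<close>-th power of the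
  cyclic shift lives on the \<open>b\<close>-th cyclic subdiagonal and has the entries \<open>d(j + b) - d(j)\<close>.

  If \<open>n\<close> is prime and \<open>b \<noteq> 0\<close>, then \<open>b\<close> generates \<open>\<int>/n\<close>, so every sequence on \<open>\<int>/n\<close> of sum zero is
  such a difference. Subtracting from a matrix the circulant one with the same cyclic
  subdiagonal means therefore leaves a sum of commutators and a diagonal matrix.

  If \<open>n = ab\<close> with \<open>1 < a, b < n\<close>, the functional \<open>X \<mapsto> \<Sum>\<^sub>j \<epsilon>\<^bsup>aj\<^esup> X\<^bsub>j+b,j\<^esub>\<close> is nonzero. It vanishes on
  \<open>D\<close> since \<open>b \<noteq> 0\<close>, on circulant matrices since \<open>\<epsilon>\<^sup>a \<noteq> 1\<close>, and on commutators since \<open>\<epsilon>\<^bsup>ab\<^esup> = 1\<close>.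
\<close>

section \<open>Adjoints and the normalized trace\<close>

lemma index_mat_adjoint:
  fixes A :: "complex mat"
  assumes "A \<in> carrier_mat n n" "i < n" "j < n"
  shows "mat_adjoint A $$ (i, j) = cnj (A $$ (j, i))"
  using assms by (auto simp: mat_adjoint_def mat_of_rows_index)

lemma mat_adjoint_carrier [simp]:
  fixes A :: "complex mat"
  shows "A \<in> carrier_mat n n \<Longrightarrow> mat_adjoint A \<in> carrier_mat n n"
  by (auto simp: mat_adjoint_def)

lemma mat_adjoint_dims [simp]:
  "dim_row (mat_adjoint A) = dim_col A" "dim_col (mat_adjoint A) = dim_row A"
  by (auto simp: mat_adjoint_def)

lemma smult_smult_mat: "a \<cdot>\<^sub>m (b \<cdot>\<^sub>m A) = (a * b) \<cdot>\<^sub>m (A :: complex mat)"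
  by (intro eq_matI) auto

lemma index_mult_square:
  fixes A :: "complex mat"
  assumes "A \<in> carrier_mat n n" "B \<in> carrier_mat n n" "i < n" "j < n"
  shows "(A * B) $$ (i, j) = (\<Sum>k<n. A $$ (i, k) * B $$ (k, j))"
  using assms by (auto simp: scalar_prod_def atLeast0LessThan)

lemma mat_adjoint_mult:
  fixes A B :: "complex mat"
  assumes "A \<in> carrier_mat n n" "B \<in> carrier_mat n n"
  shows "mat_adjoint (A * B) = mat_adjoint B * mat_adjoint A"
  using assms mult_carrier_mat[OF assms] mat_adjoint_carrier[OF assms(1)] mat_adjoint_carrier[OF assms(2)]
  by (intro eq_matI)
    (auto simp: index_mat_adjoint[of _ n] scalar_prod_def cnj_sum mult.commute intro!: sum.cong)

lemma mat_adjoint_adjoint: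
  fixes A :: "complex mat"
  assumes "A \<in> carrier_mat n n"
  shows "mat_adjoint (mat_adjoint A) = A"
  using assms mat_adjoint_carrier[OF assms]
    mat_adjoint_carrier[OF mat_adjoint_carrier[OF assms]]
  by (intro eq_matI) (auto simp: index_mat_adjoint[of _ n])

lemma normalized_trace_mult:
  assumes "A \<in> carrier_mat n n" "B \<in> carrier_mat n n"
  shows "normalized_trace n (A * B) = (1 / of_nat n) * (\<Sum>i<n. \<Sum>j<n. A $$ (i, j) * B $$ (j, i))"
  using assms by (simp add: normalized_trace_def scalar_prod_def atLeast0LessThan)

lemma normalized_trace_commute:
  assumes "A \<in> carrier_mat n n" "B \<in> carrier_mat n n"
  shows "normalized_trace n (A * B) = normalized_trace n (B * A)"
  unfolding normalized_trace_mult[OF assms] normalized_trace_mult[OF assms(2,1)]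
  by (subst sum.swap) (simp add: mult.commute)

lemma adjoint_mult_diag_entry:
  assumes "A \<in> carrier_mat n n" "i < n"
  shows "(mat_adjoint A * A) $$ (i, i) = of_real (\<Sum>k<n. (cmod (A $$ (k, i)))\<^sup>2)"
  using assms mat_adjoint_carrier[OF assms(1)]
  by (simp add: scalar_prod_def index_mat_adjoint[of _ n] atLeast0LessThan
      complex_norm_square mult.commute[of "cnj _"] del: of_real_power)

text \<open>Up to the factor 1/n this is the squared Hilbert-Schmidt norm, so positivity and
  faithfulness of the trace can be read off.\<close>

lemma normalized_trace_adjoint_mult:
  assumes "A \<in> carrier_mat n n"
  shows "normalized_trace n (mat_adjoint A * A) =
    of_real ((\<Sum>i<n. \<Sum>k<n. (cmod (A $$ (k, i)))\<^sup>2) / of_nat n)"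
  using assms by (simp add: normalized_trace_def adjoint_mult_diag_entry del: index_mult_mat)

lemma faithful_normalized_trace_normalized_trace:
  assumes "n > 0"
  shows "faithful_normalized_trace n (carrier_mat n n) (normalized_trace n)"
  unfolding faithful_normalized_trace_def
proof (intro conjI ballI allI impI)
  fix x :: "complex mat" assume x: "x \<in> carrier_mat n n"
  show "0 \<le> normalized_trace n (mat_adjoint x * x)"
    unfolding normalized_trace_adjoint_mult[OF x]
    by (simp add: less_eq_complex_def sum_nonneg)
  assume "normalized_trace n (mat_adjoint x * x) = 0"
  then have "(\<Sum>i<n. \<Sum>k<n. (cmod (x $$ (k, i)))\<^sup>2) = 0"
    using assms unfolding normalized_trace_adjoint_mult[OF x] of_real_eq_0_iff by simp
  then have "x $$ (k, i) = 0" if "i < n" "k < n" for i k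
    using that by (simp add: sum_nonneg_eq_0_iff sum_nonneg)
  then show "x = 0\<^sub>m n n" using x by (intro eq_matI) auto
next
  fix x y :: "complex mat" assume "x \<in> carrier_mat n n" "y \<in> carrier_mat n n"
  then show "normalized_trace n (x * y) = normalized_trace n (y * x)"
    by (rule normalized_trace_commute)
qed (use assms in \<open>auto simp: normalized_trace_def sum.distrib distrib_left sum_distrib_left mult_ac\<close>)

section \<open>The full, diagonal and scalar matrices as von Neumann algebras\<close>

lemma vN_algebra_carrier: "vN_algebra n (carrier_mat n n)"
  by (auto simp: vN_algebra_def)

lemma vN_algebra_diagonal: "vN_algebra n (diagonal_algebra n)"
  unfolding vN_algebra_def diagonal_algebra_def
proof (intro conjI ballI allI)
  fix x y :: "complex mat"
  assume x: "x \<in> {A \<in> carrier_mat n n. diagonal_mat A}" and y: "y \<in> {A \<in> carrier_mat n n. diagonal_mat A}"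
  have "(\<Sum>k\<in>{0..<n}. x $$ (i, k) * y $$ (k, j)) = 0" if "i < n" "j < n" "i \<noteq> j" for i j
    using x y that by (intro sum.neutral) (auto simp: diagonal_mat_def, metis)
  then show "x * y \<in> {A \<in> carrier_mat n n. diagonal_mat A}"
    using x y by (auto simp: diagonal_mat_def scalar_prod_def)
next
  fix x :: "complex mat"
  assume x: "x \<in> {A \<in> carrier_mat n n. diagonal_mat A}"
  then show "mat_adjoint x \<in> {A \<in> carrier_mat n n. diagonal_mat A}"
    using mat_adjoint_carrier[of x n] by (auto simp: diagonal_mat_def index_mat_adjoint[of _ n])
qed (auto simp: diagonal_mat_def)

lemma vN_algebra_scalar: "vN_algebra n (scalar_algebra n)"
proof -
  have add: "a \<cdot>\<^sub>m 1\<^sub>m n + b \<cdot>\<^sub>m 1\<^sub>m n = (a + b) \<cdot>\<^sub>m (1\<^sub>m n :: complex mat)" for a b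
    by (simp add: add_smult_distrib_right_mat[of _ n n])
  have adj: "mat_adjoint (a \<cdot>\<^sub>m 1\<^sub>m n) = cnj a \<cdot>\<^sub>m (1\<^sub>m n :: complex mat)" for a
    using mat_adjoint_carrier[of "a \<cdot>\<^sub>m 1\<^sub>m n" n]
    by (intro eq_matI) (auto simp: index_mat_adjoint[of _ n])
  have one: "1\<^sub>m n = 1 \<cdot>\<^sub>m (1\<^sub>m n :: complex mat)"
    by (intro eq_matI) auto
  have mult: "(a \<cdot>\<^sub>m 1\<^sub>m n) * (b \<cdot>\<^sub>m 1\<^sub>m n) = (a * b) \<cdot>\<^sub>m (1\<^sub>m n :: complex mat)" for a b
    by (simp add: mult_smult_distrib[of _ n n _ n] mult_smult_assoc_mat[of _ n n _ n] smult_smult_mat mult.commute)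
  show ?thesis
    unfolding vN_algebra_def scalar_algebra_def
    using one by (auto simp: add adj mult smult_smult_mat; blast)
qed

section \<open>Conditional expectations\<close>

text \<open>Compression to the main diagonal is the trace-invariant expectation onto D. It returns
  in the prime case, where it splits off the main diagonal.\<close>

definition diag_part :: "nat \<Rightarrow> complex mat \<Rightarrow> complex mat" where
  "diag_part n X = mat n n (\<lambda>(i, j). if i = j then X $$ (i, i) else 0)"

lemma diagonal_algebra_zero:
  "a \<in> diagonal_algebra n \<Longrightarrow> i < n \<Longrightarrow> j < n \<Longrightarrow> i \<noteq> j \<Longrightarrow> a $$ (i, j) = 0"
  by (auto simp: diagonal_algebra_def diagonal_mat_def)

lemma diagonal_mult_index:
  assumes "a \<in> diagonal_algebra n" "x \<in> carrier_mat n n" "i < n" "j < n"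
  shows "(a * x) $$ (i, j) = a $$ (i, i) * x $$ (i, j)"
proof -
  have "(a * x) $$ (i, j) = (\<Sum>k\<in>{0..<n}. a $$ (i, k) * x $$ (k, j))"
    using assms by (auto simp: diagonal_algebra_def scalar_prod_def)
  also have "\<dots> = (\<Sum>k\<in>{0..<n}. if k = i then a $$ (i, i) * x $$ (i, j) else 0)"
    using assms by (intro sum.cong) (auto simp: diagonal_algebra_zero)
  finally show ?thesis using assms by simp
qed

lemma mult_diagonal_index:
  assumes "a \<in> diagonal_algebra n" "x \<in> carrier_mat n n" "i < n" "j < n"
  shows "(x * a) $$ (i, j) = x $$ (i, j) * a $$ (j, j)"
proof -
  have "(x * a) $$ (i, j) = (\<Sum>k\<in>{0..<n}. x $$ (i, k) * a $$ (k, j))"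
    using assms by (auto simp: diagonal_algebra_def scalar_prod_def)
  also have "\<dots> = (\<Sum>k\<in>{0..<n}. if k = j then x $$ (i, j) * a $$ (j, j) else 0)"
    using assms by (intro sum.cong) (auto simp: diagonal_algebra_zero)
  finally show ?thesis using assms by simp
qed

lemma diagonal_algebra_carrier: "a \<in> diagonal_algebra n \<Longrightarrow> a \<in> carrier_mat n n"
  by (simp add: diagonal_algebra_def)

text \<open>The positivity clause of \<open>is_cond_exp\<close> asks for a witness inside the
  subalgebra. Entrywise real square roots provide it.\<close>

lemma adjoint_mult_diagonal_ex:
  assumes "\<And>i. i < n \<Longrightarrow> (0::real) \<le> r i"
  shows "\<exists>y\<in>diagonal_algebra n. mat n n (\<lambda>(i, j). if i = j then of_real (r i) else 0) = mat_adjoint y * y"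
proof
  let ?y = "mat n n (\<lambda>(i, j). if i = j then complex_of_real (sqrt (r i)) else 0)"
  have y: "?y \<in> carrier_mat n n" by simp
  show yd: "?y \<in> diagonal_algebra n"
    by (auto simp: diagonal_algebra_def diagonal_mat_def)
  then have ad: "mat_adjoint ?y \<in> diagonal_algebra n"
    using vN_algebra_diagonal unfolding vN_algebra_def by blast
  show "mat n n (\<lambda>(i, j). if i = j then of_real (r i) else 0) = mat_adjoint ?y * ?y"
  proof (rule eq_matI)
    fix i j assume "i < dim_row (mat_adjoint ?y * ?y)" "j < dim_col (mat_adjoint ?y * ?y)"
    then have ij: "i < n" "j < n" by auto
    show "mat n n (\<lambda>(i, j). if i = j then of_real (r i) else 0) $$ (i, j) = (mat_adjoint ?y * ?y) $$ (i, j)"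
      unfolding diagonal_mult_index[OF ad y ij] index_mat_adjoint[OF y ij(1) ij(1)]
      using ij assms by (simp flip: of_real_mult)
  qed auto
qed

lemma is_cond_exp_diag_part:
  "is_cond_exp (normalized_trace n) (carrier_mat n n) (diagonal_algebra n) (diag_part n)"
  unfolding is_cond_exp_def
proof (intro conjI ballI allI)
  fix x :: "complex mat" assume x: "x \<in> carrier_mat n n"
  have "diag_part n (mat_adjoint x * x) =
      mat n n (\<lambda>(i, j). if i = j then of_real (\<Sum>k<n. (cmod (x $$ (k, i)))\<^sup>2) else 0)"
    unfolding diag_part_def
    by (intro cong_mat) (auto simp: adjoint_mult_diag_entry[OF x] simp del: index_mult_mat of_real_sum)
  then show "\<exists>y\<in>diagonal_algebra n. diag_part n (mat_adjoint x * x) = mat_adjoint y * y"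
    using adjoint_mult_diagonal_ex[of n "\<lambda>i. \<Sum>k<n. (cmod (x $$ (k, i)))\<^sup>2"] by (simp add: sum_nonneg)
next
  fix a b x :: "complex mat"
  assume a: "a \<in> diagonal_algebra n" and b: "b \<in> diagonal_algebra n" and x: "x \<in> carrier_mat n n"
  have c: "a \<in> carrier_mat n n" "b \<in> carrier_mat n n" "a * x \<in> carrier_mat n n"
      "diag_part n x \<in> carrier_mat n n" "a * diag_part n x \<in> carrier_mat n n"
    using a b x by (auto simp: diagonal_algebra_def diag_part_def)
  show "diag_part n (a * x * b) = a * diag_part n x * b"
  proof (rule eq_matI)
    fix i j assume "i < dim_row (a * diag_part n x * b)" "j < dim_col (a * diag_part n x * b)"
    then have ij: "i < n" "j < n" using c by auto
    show "diag_part n (a * x * b) $$ (i, j) = (a * diag_part n x * b) $$ (i, j)"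
      unfolding mult_diagonal_index[OF b c(5) ij] diagonal_mult_index[OF a c(4) ij]
      using ij by (simp add: diag_part_def mult_diagonal_index[OF b c(3)] diagonal_mult_index[OF a x]
          del: index_mult_mat)
  qed (use c in \<open>auto simp: diag_part_def\<close>)
qed (auto simp: diag_part_def diagonal_algebra_def diagonal_mat_def normalized_trace_def intro!: eq_matI)

lemma adjoint_mult_scalar_ex:
  assumes "(0::real) \<le> r"
  shows "\<exists>y\<in>scalar_algebra n. of_real r \<cdot>\<^sub>m 1\<^sub>m n = mat_adjoint y * y"
proof
  let ?y = "complex_of_real (sqrt r) \<cdot>\<^sub>m 1\<^sub>m n"
  show "?y \<in> scalar_algebra n"
    by (auto simp: scalar_algebra_def)
  have sq: "complex_of_real (sqrt r) * complex_of_real (sqrt r) = of_real r"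
    using assms by (simp flip: of_real_mult)
  have "mat_adjoint ?y = ?y"
    by (intro eq_matI) (auto simp: index_mat_adjoint[of _ n])
  then show "of_real r \<cdot>\<^sub>m 1\<^sub>m n = mat_adjoint ?y * ?y"
    by (simp add: mult_smult_distrib[of _ n n _ n] mult_smult_assoc_mat[of _ n n _ n] smult_smult_mat sq)
qed

lemma is_cond_exp_scalar:
  assumes "n > 0"
  shows "is_cond_exp (normalized_trace n) (carrier_mat n n) (scalar_algebra n)
    (\<lambda>x. normalized_trace n x \<cdot>\<^sub>m 1\<^sub>m n)"
  unfolding is_cond_exp_def
proof (intro conjI ballI allI)
  fix x :: "complex mat" assume x: "x \<in> carrier_mat n n"
  let ?r = "(\<Sum>i<n. \<Sum>k<n. (cmod (x $$ (k, i)))\<^sup>2) / of_nat n"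
  have "0 \<le> ?r" by (intro divide_nonneg_nonneg sum_nonneg) auto
  then show "\<exists>y\<in>scalar_algebra n. normalized_trace n (mat_adjoint x * x) \<cdot>\<^sub>m 1\<^sub>m n = mat_adjoint y * y"
    unfolding normalized_trace_adjoint_mult[OF x] by (rule adjoint_mult_scalar_ex)
next
  fix a b x :: "complex mat"
  assume a: "a \<in> scalar_algebra n" and b: "b \<in> scalar_algebra n" and x: "x \<in> carrier_mat n n"
  then obtain c d where [simp]: "a = c \<cdot>\<^sub>m 1\<^sub>m n" "b = d \<cdot>\<^sub>m 1\<^sub>m n" by (auto simp: scalar_algebra_def)
  have ab: "a * y * b = (c * d) \<cdot>\<^sub>m y" if "y \<in> carrier_mat n n" for y
    using that by (simp add: mult_smult_distrib[of _ n n _ n] mult_smult_assoc_mat[of _ n n _ n] smult_smult_mat mult.commute)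
  show "normalized_trace n (a * x * b) \<cdot>\<^sub>m 1\<^sub>m n = a * (normalized_trace n x \<cdot>\<^sub>m 1\<^sub>m n) * b"
    unfolding ab[OF x] ab[OF smult_carrier_mat[OF one_carrier_mat]]
    using x by (simp add: normalized_trace_def smult_smult_mat sum_distrib_left mult_ac)
qed (use assms in \<open>auto simp: normalized_trace_def scalar_algebra_def sum_distrib_left sum.distrib
  distrib_left distrib_right mult_ac intro!: eq_matI\<close>)

section \<open>Conjugation by a unitary matrix\<close>

definition unitary :: "nat \<Rightarrow> complex mat \<Rightarrow> bool" where
  "unitary n U \<longleftrightarrow> U \<in> carrier_mat n n \<and> mat_adjoint U * U = 1\<^sub>m n \<and> U * mat_adjoint U = 1\<^sub>m n"

text \<open>For unitary U this is a trace-preserving star-automorphism of the full matrix algebra,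
  with inverse \<open>conj_by (mat_adjoint U)\<close>. The structure of D is carried over to the
  conjugate algebra along it.\<close>

definition conj_by :: "complex mat \<Rightarrow> complex mat \<Rightarrow> complex mat" where
  "conj_by U X = mat_adjoint U * X * U"

lemma conjugate_algebra_eq: "conjugate_algebra U A = conj_by U ` A"
  by (auto simp: conjugate_algebra_def conj_by_def)

lemma unitary_adjoint: "unitary n U \<Longrightarrow> unitary n (mat_adjoint U)"
  by (auto simp: unitary_def mat_adjoint_adjoint)

context
  fixes n :: nat and U :: "complex mat"
  assumes U: "unitary n U"
begin

private lemma Uc: "U \<in> carrier_mat n n" "mat_adjoint U \<in> carrier_mat n n"
  using U by (auto simp: unitary_def)

lemma conj_by_carrier: "x \<in> carrier_mat n n \<Longrightarrow> conj_by U x \<in> carrier_mat n n"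
  using Uc by (auto simp: conj_by_def)

lemma conj_by_adjoint_conj_by:
  assumes "x \<in> carrier_mat n n"
  shows "conj_by (mat_adjoint U) (conj_by U x) = x"
proof -
  have "conj_by (mat_adjoint U) (conj_by U x) = (U * mat_adjoint U) * x * (U * mat_adjoint U)"
    unfolding conj_by_def mat_adjoint_adjoint[OF Uc(1)]
    using assms Uc by (simp add: assoc_mult_mat[of _ n n _ n _ n] mult_carrier_mat[of _ n n _ n])
  then show ?thesis using U assms by (simp add: unitary_def)
qed

lemma conj_by_mult:
  assumes "x \<in> carrier_mat n n" "y \<in> carrier_mat n n"
  shows "conj_by U (x * y) = conj_by U x * conj_by U y"
proof -
  have "conj_by U x * conj_by U y = mat_adjoint U * x * (U * mat_adjoint U) * y * U"
    unfolding conj_by_def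
    using assms Uc by (simp add: assoc_mult_mat[of _ n n _ n _ n] mult_carrier_mat[of _ n n _ n])
  also have "U * mat_adjoint U = 1\<^sub>m n"
    using U by (simp add: unitary_def)
  also have "mat_adjoint U * x * 1\<^sub>m n * y * U = conj_by U (x * y)"
    using assms Uc by (simp add: conj_by_def assoc_mult_mat[of _ n n _ n _ n] mult_carrier_mat[of _ n n _ n])
  finally show ?thesis ..
qed

lemma conj_by_add:
  assumes "x \<in> carrier_mat n n" "y \<in> carrier_mat n n"
  shows "conj_by U (x + y) = conj_by U x + conj_by U y"
  using assms Uc
  by (simp add: conj_by_def mult_add_distrib_mat[of _ n n _ n] add_mult_distrib_mat[of _ n n _ _ n]
      mult_carrier_mat[of _ n n _ n])

lemma conj_by_smult:
  assumes "x \<in> carrier_mat n n"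
  shows "conj_by U (c \<cdot>\<^sub>m x) = c \<cdot>\<^sub>m conj_by U x"
  using assms Uc
  by (simp add: conj_by_def mult_smult_distrib[of _ n n _ n] mult_smult_assoc_mat[of _ n n _ n]
      mult_carrier_mat[of _ n n _ n])

lemma conj_by_one: "conj_by U (1\<^sub>m n) = 1\<^sub>m n"
  using U Uc by (simp add: conj_by_def unitary_def)

lemma conj_by_mat_adjoint:
  assumes "x \<in> carrier_mat n n"
  shows "conj_by U (mat_adjoint x) = mat_adjoint (conj_by U x)"
  using assms Uc
  by (simp add: conj_by_def mat_adjoint_mult[of _ n] mat_adjoint_adjoint[of _ n] assoc_mult_mat[of _ n n _ n _ n] mult_carrier_mat[of _ n n _ n])

lemma normalized_trace_conj_by:
  assumes "x \<in> carrier_mat n n"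
  shows "normalized_trace n (conj_by U x) = normalized_trace n x"
proof -
  have "normalized_trace n (conj_by U x) = normalized_trace n (U * (mat_adjoint U * x))"
    unfolding conj_by_def using assms Uc by (intro normalized_trace_commute) auto
  also have "U * (mat_adjoint U * x) = (U * mat_adjoint U) * x"
    using assms Uc by (simp add: assoc_mult_mat[of _ n n _ n _ n] mult_carrier_mat[of _ n n _ n])
  finally show ?thesis using U assms by (simp add: unitary_def)
qed

lemma vN_algebra_conjugate:
  assumes A: "vN_algebra n A"
  shows "vN_algebra n (conjugate_algebra U A)"
proof -
  have c: "x \<in> carrier_mat n n" if "x \<in> A" for x using A that by (auto simp: vN_algebra_def)
  show ?thesis
    unfolding vN_algebra_def conjugate_algebra_eq
    using A conj_by_one[symmetric]
    by (auto simp: vN_algebra_def c conj_by_carrier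
        simp flip: conj_by_mult conj_by_add conj_by_smult conj_by_mat_adjoint)
qed

end

text \<open>Transport of structure: pull back, apply \<open>E\<close>, push forward. Invariance of
  the trace uses \<open>normalized_trace_conj_by\<close> for both U and its adjoint.\<close>

lemma is_cond_exp_conjugate:
  assumes U: "unitary n U" and A: "A \<subseteq> carrier_mat n n"
    and E: "is_cond_exp (normalized_trace n) (carrier_mat n n) A E"
  shows "is_cond_exp (normalized_trace n) (carrier_mat n n) (conjugate_algebra U A)
     (\<lambda>x. conj_by U (E (conj_by (mat_adjoint U) x)))"
proof -
  note V = unitary_adjoint[OF U]
  have c: "x \<in> carrier_mat n n" if "x \<in> A" for x using A that by auto
  have EA: "E x \<in> A" if "x \<in> carrier_mat n n" for x
    using E that by (auto simp: is_cond_exp_def)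
  have Ec: "E x \<in> carrier_mat n n" if "x \<in> carrier_mat n n" for x
    using EA[OF that] c by auto
  note simps = conj_by_carrier[OF U] conj_by_carrier[OF V] c Ec EA conj_by_adjoint_conj_by[OF U]
    normalized_trace_conj_by[OF U] normalized_trace_conj_by[OF V]
  show ?thesis
    unfolding is_cond_exp_def conjugate_algebra_eq
  proof (intro conjI ballI allI)
    fix x :: "complex mat" assume x: "x \<in> carrier_mat n n"
    let ?x = "conj_by (mat_adjoint U) x"
    obtain y where y: "y \<in> A" "E (mat_adjoint ?x * ?x) = mat_adjoint y * y"
      using E conj_by_carrier[OF V x] unfolding is_cond_exp_def by meson
    have "conj_by U (E (conj_by (mat_adjoint U) (mat_adjoint x * x)))
        = mat_adjoint (conj_by U y) * conj_by U y"
      using x y by (simp add: conj_by_mult[OF V] conj_by_mat_adjoint[OF V] simps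
         conj_by_mult[OF U] conj_by_mat_adjoint[OF U])
    then show "\<exists>y\<in>conj_by U ` A. conj_by U (E (conj_by (mat_adjoint U) (mat_adjoint x * x))) = mat_adjoint y * y"
      using y by blast
  qed (use E in \<open>auto simp: is_cond_exp_def simps conj_by_mult[OF V] conj_by_mult[OF U]
      conj_by_add[OF V] conj_by_add[OF U] conj_by_smult[OF V] conj_by_smult[OF U]
      mult_carrier_mat[of _ n n _ n]\<close>)
qed

text \<open>Indices below n are their own residues. This turns the divisibility test of
  \<open>sum_unit_root\<close> into a Kronecker delta.\<close>

lemma int_dvd_diff_iff:
  assumes "i < n" "j < n"
  shows "int n dvd int i - int j \<longleftrightarrow> i = j"
  using assms by (simp flip: mod_eq_dvd_iff)

section \<open>The commuting square\<close>

text \<open>The powers of \<epsilon> = \<open>unit_root n 1\<close>, with integer exponents so that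
  negative index differences need no separate treatment.\<close>

definition unit_root :: "nat \<Rightarrow> int \<Rightarrow> complex" where
  "unit_root n k = cis (2 * pi * of_int k / of_nat n)"

lemma unit_root_add: "unit_root n (a + b) = unit_root n a * unit_root n b"
  by (simp add: unit_root_def cis_mult add_divide_distrib ring_distribs)

lemma unit_root_uminus: "unit_root n (- a) = cnj (unit_root n a)"
  by (simp add: unit_root_def cis_cnj)

lemma unit_root_power: "unit_root n a ^ k = unit_root n (a * int k)"
  by (simp add: unit_root_def DeMoivre mult_ac)

lemma unit_root_eq_1_iff:
  assumes "n > 0"
  shows "unit_root n k = 1 \<longleftrightarrow> int n dvd k"
proof
  assume "unit_root n k = 1"
  \<comment> \<open>The real part suffices: a cosine equal to 1 already forces the angle to be a
    multiple of 2 pi.\<close>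
  then have "cos (2 * pi * of_int k / of_nat n) = 1"
    by (metis unit_root_def cis.sel(1) one_complex.sel(1))
  then obtain m :: int where "2 * pi * of_int k / of_nat n = of_int m * 2 * pi"
    unfolding cos_one_2pi_int by blast
  then have "real_of_int k = of_int (int n * m)"
    using assms by (simp add: field_simps)
  then have "k = int n * m"
    unfolding of_int_eq_iff .
  then show "int n dvd k" by simp
next
  assume "int n dvd k"
  then obtain m where "k = int n * m" ..
  then have "unit_root n k = cis (of_int m * (2 * pi))"
    using assms by (simp add: unit_root_def mult_ac)
  also have "\<dots> = 1"
    by (metis cis_multiple_2pi Ints_of_int mult.commute mult.left_commute)
  finally show "unit_root n k = 1" .
qed

lemma unit_root_mod:
  assumes "n > 0" "a mod int n = b mod int n"
  shows "unit_root n a = unit_root n b"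
proof -
  have "unit_root n a = unit_root n (b + (a - b))" by simp
  also have "\<dots> = unit_root n b"
    using assms unit_root_eq_1_iff[of n "a - b"] by (simp only: unit_root_add) (simp add: mod_eq_dvd_iff)
  finally show ?thesis .
qed

text \<open>A geometric sum whose ratio is an n-th root of unity. This orthogonality of characters
  yields unitarity of U, Fourier inversion, and later the vanishing of the functional on circulant
  matrices.\<close>

lemma sum_unit_root:
  assumes "n > 0"
  shows "(\<Sum>k<n. unit_root n (int k * m)) = (if int n dvd m then of_nat n else 0)"
proof -
  have "(\<Sum>k<n. unit_root n (int k * m)) = (\<Sum>k<n. unit_root n m ^ k)"
    by (simp add: unit_root_power mult.commute)
  also have "\<dots> = (if int n dvd m then of_nat n else 0)"
  proof (cases "int n dvd m")
    case True
    then show ?thesis using unit_root_eq_1_iff[OF assms, of m] by simp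
  next
    case False
    have "unit_root n m ^ n = 1"
      unfolding unit_root_power unit_root_eq_1_iff[OF assms] by simp
    moreover have "unit_root n m \<noteq> 1"
      unfolding unit_root_eq_1_iff[OF assms] by (rule False)
    ultimately show ?thesis using False by (simp add: geometric_sum)
  qed
  finally show ?thesis .
qed

lemma standard_biunitary_eq:
  "standard_biunitary n = mat n n (\<lambda>(i, j). of_real (1 / sqrt n) * unit_root n (int i * int j))"
proof -
  have "complex_of_real (cos (2 * pi / real n)) + \<i> * complex_of_real (sin (2 * pi / real n)) = unit_root n 1"
    by (simp add: unit_root_def complex_eq_iff)
  then show ?thesis
    by (intro eq_matI) (auto simp: standard_biunitary_def Let_def unit_root_power)
qed

lemma standard_biunitary_carrier: "standard_biunitary n \<in> carrier_mat n n"
  by (simp add: standard_biunitary_eq)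

text \<open>Conjugating one factor negates its exponent, so only the difference j - i survives. This
  is the source of the circulant form of the conjugate algebra.\<close>

lemma cnj_standard_biunitary_mult:
  assumes "n > 0" "k < n" "i < n" "j < n"
  shows "cnj (standard_biunitary n $$ (k, i)) * standard_biunitary n $$ (k, j)
    = unit_root n (int k * (int j - int i)) / of_nat n"
proof -
  have "complex_of_real (sqrt n) * complex_of_real (sqrt n) = of_nat n"
    by (simp flip: of_real_mult)
  moreover have "unit_root n (int k * (int j - int i)) = cnj (unit_root n (int k * int i)) * unit_root n (int k * int j)"
    by (simp add: right_diff_distrib flip: unit_root_add unit_root_uminus)
  ultimately show ?thesis
    using assms by (simp add: standard_biunitary_eq)
qed

lemma index_conj_by_standard_biunitary:
  assumes "n > 0" "d \<in> diagonal_algebra n" "i < n" "j < n"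
  shows "conj_by (standard_biunitary n) d $$ (i, j)
     = (\<Sum>k<n. d $$ (k, k) * unit_root n (int k * (int j - int i))) / of_nat n"
proof -
  let ?U = "standard_biunitary n"
  note U = standard_biunitary_carrier[of n] and d = diagonal_algebra_carrier[OF assms(2)]
  have "conj_by ?U d $$ (i, j) = (\<Sum>k<n. (mat_adjoint ?U * d) $$ (i, k) * ?U $$ (k, j))"
    unfolding conj_by_def
    by (rule index_mult_square[OF mult_carrier_mat[OF mat_adjoint_carrier[OF U] d] U assms(3,4)])
  also have "\<dots> = (\<Sum>k<n. d $$ (k, k) * (cnj (?U $$ (k, i)) * ?U $$ (k, j)))"
    using assms U by (intro sum.cong)
      (auto simp: mult_diagonal_index[OF assms(2), of "mat_adjoint ?U"] index_mat_adjoint[of _ n]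
        simp del: index_mult_mat)
  finally show ?thesis
    using assms by (simp add: cnj_standard_biunitary_mult sum_divide_distrib)
qed

lemma unitary_standard_biunitary:
  assumes "n > 0"
  shows "unitary n (standard_biunitary n)"
proof -
  let ?U = "standard_biunitary n"
  note U = standard_biunitary_carrier[of n]
  have "mat_adjoint ?U * ?U = 1\<^sub>m n"
  proof (rule eq_matI)
    fix i j assume "i < dim_row (1\<^sub>m n)" "j < dim_col (1\<^sub>m n)"
    then have ij: "i < n" "j < n" by auto
    have "(mat_adjoint ?U * ?U) $$ (i, j) = (\<Sum>k<n. cnj (?U $$ (k, i)) * ?U $$ (k, j))"
      using U ij by (auto simp: scalar_prod_def index_mat_adjoint[of _ n] atLeast0LessThan intro!: sum.cong)
    also have "\<dots> = (\<Sum>k<n. unit_root n (int k * (int j - int i))) / of_nat n"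
      using assms ij by (simp add: cnj_standard_biunitary_mult sum_divide_distrib)
    also have "\<dots> = 1\<^sub>m n $$ (i, j)"
      using assms ij by (auto simp: sum_unit_root int_dvd_diff_iff)
    finally show "(mat_adjoint ?U * ?U) $$ (i, j) = 1\<^sub>m n $$ (i, j)" .
  qed (use U in auto)
  with mat_mult_left_right_inverse[OF mat_adjoint_carrier[OF U] U] U show ?thesis
    by (auto simp: unitary_def)
qed

lemma commuting_square_standard_biunitary:
  assumes "n > 0"
  shows "commuting_square n (normalized_trace n) (scalar_algebra n) (diagonal_algebra n)
     (conjugate_algebra (standard_biunitary n) (diagonal_algebra n)) (carrier_mat n n)"
proof -
  let ?U = "standard_biunitary n"
  note U = unitary_standard_biunitary[OF assms]
  have D: "diagonal_algebra n \<subseteq> carrier_mat n n"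
    by (auto simp: diagonal_algebra_def)
  have sD: "scalar_algebra n \<subseteq> diagonal_algebra n"
    by (auto simp: diagonal_algebra_def diagonal_mat_def scalar_algebra_def)
  have "scalar_algebra n \<subseteq> conjugate_algebra ?U (diagonal_algebra n)"
  proof
    fix x assume x: "x \<in> scalar_algebra n"
    then obtain c where c: "x = c \<cdot>\<^sub>m 1\<^sub>m n" by (auto simp: scalar_algebra_def)
    have "conj_by ?U x = x"
      unfolding c conj_by_smult[OF U one_carrier_mat] conj_by_one[OF U] ..
    then show "x \<in> conjugate_algebra ?U (diagonal_algebra n)"
      unfolding conjugate_algebra_eq using x sD by (metis image_eqI subsetD)
  qed
  moreover have "conjugate_algebra ?U (diagonal_algebra n) \<subseteq> carrier_mat n n"
    unfolding conjugate_algebra_eq using conj_by_carrier[OF U] D by auto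
  moreover have "diag_part n (conj_by ?U (diag_part n (conj_by (mat_adjoint ?U) x))) =
    normalized_trace n x \<cdot>\<^sub>m 1\<^sub>m n" if x: "x \<in> carrier_mat n n" for x
  proof -
    let ?d = "diag_part n (conj_by (mat_adjoint ?U) x)"
    have d: "?d \<in> diagonal_algebra n"
      by (auto simp: diag_part_def diagonal_algebra_def diagonal_mat_def)
    \<comment> \<open>On the diagonal the exponent j - i vanishes, so every diagonal entry is the
      mean of the entries of \<open>?d\<close>. Equivalently, all entries of U have modulus 1/sqrt
      n. This is what makes the square commute.\<close>
    have "conj_by ?U ?d $$ (i, i) = normalized_trace n ?d" if "i < n" for i
      unfolding index_conj_by_standard_biunitary[OF assms d that that]
      by (simp add: normalized_trace_def unit_root_def)
    also have "normalized_trace n ?d = normalized_trace n (conj_by (mat_adjoint ?U) x)"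
      by (simp add: normalized_trace_def diag_part_def)
    also have "\<dots> = normalized_trace n x"
      by (rule normalized_trace_conj_by[OF unitary_adjoint[OF U] x])
    finally show ?thesis
      by (subst diag_part_def) (auto intro!: eq_matI)
  qed
  ultimately show ?thesis
    unfolding commuting_square_def
    using D sD vN_algebra_carrier vN_algebra_diagonal vN_algebra_scalar vN_algebra_conjugate[OF U vN_algebra_diagonal]
      faithful_normalized_trace_normalized_trace[OF assms]
      is_cond_exp_diag_part is_cond_exp_scalar[OF assms] is_cond_exp_conjugate[OF U D is_cond_exp_diag_part]
    by (intro conjI exI) (assumption | blast)+
qed

section \<open>Circulant matrices and commutants\<close>

text \<open>The value c(b) fills the b-th cyclic subdiagonal. Only the values of \<open>c\<close> at
  0, ..., n-1 matter, and integer subtraction avoids truncation.\<close>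

definition circulant :: "nat \<Rightarrow> (int \<Rightarrow> complex) \<Rightarrow> complex mat" where
  "circulant n c = mat n n (\<lambda>(i, j). c ((int i - int j) mod int n))"

lemma circulant_carrier [simp]: "circulant n c \<in> carrier_mat n n"
  by (simp add: circulant_def)

lemma index_circulant:
  "i < n \<Longrightarrow> j < n \<Longrightarrow> circulant n c $$ (i, j) = c ((int i - int j) mod int n)"
  by (simp add: circulant_def)

text \<open>The entries found in \<open>index_conj_by_standard_biunitary\<close> depend on i - j
  modulo n only; the symbol is the inverse discrete Fourier transform of the diagonal.\<close>

lemma conj_by_diagonal_eq_circulant:
  assumes "n > 0" "d \<in> diagonal_algebra n"
  shows "conj_by (standard_biunitary n) d
    = circulant n (\<lambda>m. (\<Sum>k<n. d $$ (k, k) * unit_root n (- (int k * m))) / of_nat n)"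
proof (rule eq_matI)
  fix i j assume "i < dim_row (circulant n (\<lambda>m. (\<Sum>k<n. d $$ (k, k) * unit_root n (- (int k * m))) / of_nat n))"
    "j < dim_col (circulant n (\<lambda>m. (\<Sum>k<n. d $$ (k, k) * unit_root n (- (int k * m))) / of_nat n))"
  then have ij: "i < n" "j < n" by (auto simp: circulant_def)
  have "unit_root n (int k * (int j - int i)) = unit_root n (- (int k * ((int i - int j) mod int n)))" for k
  proof (rule unit_root_mod[OF assms(1)])
    have "- (int k * ((int i - int j) mod int n)) mod int n = - (int k * (int i - int j)) mod int n"
      by (metis mod_minus_cong mod_mult_right_eq)
    then show "int k * (int j - int i) mod int n = - (int k * ((int i - int j) mod int n)) mod int n"
      by (simp add: algebra_simps)
  qed
  then show "conj_by (standard_biunitary n) d $$ (i, j) =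
     circulant n (\<lambda>m. (\<Sum>k<n. d $$ (k, k) * unit_root n (- (int k * m))) / of_nat n) $$ (i, j)"
    by (simp add: index_circulant ij index_conj_by_standard_biunitary[OF assms ij])
qed (use conj_by_carrier[OF unitary_standard_biunitary[OF assms(1)] diagonal_algebra_carrier[OF assms(2)]]
    in \<open>auto simp: circulant_def\<close>)

lemma circulant_eq_conj_by_diagonal:
  assumes "n > 0"
  shows "\<exists>d\<in>diagonal_algebra n. circulant n c = conj_by (standard_biunitary n) d"
proof
  \<comment> \<open>The forward Fourier transform of \<open>c\<close>, undoing the transform in
    \<open>conj_by_diagonal_eq_circulant\<close>.\<close>
  let ?f = "\<lambda>k. \<Sum>m<n. c (int m) * unit_root n (int k * int m)"
  let ?d = "mat n n (\<lambda>(i, j). if i = j then ?f i else 0)"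
  show d: "?d \<in> diagonal_algebra n"
    by (auto simp: diagonal_algebra_def diagonal_mat_def)
  show "circulant n c = conj_by (standard_biunitary n) ?d"
    unfolding conj_by_diagonal_eq_circulant[OF assms d]
  proof (rule eq_matI)
    fix i j assume "i < dim_row (circulant n (\<lambda>m. (\<Sum>k<n. ?d $$ (k, k) * unit_root n (- (int k * m))) / of_nat n))"
      "j < dim_col (circulant n (\<lambda>m. (\<Sum>k<n. ?d $$ (k, k) * unit_root n (- (int k * m))) / of_nat n))"
    then have ij: "i < n" "j < n" by (auto simp: circulant_def)
    define p where "p = nat ((int i - int j) mod int n)"
    have p: "int p = (int i - int j) mod int n" "p < n"
      using assms by (auto simp: p_def nat_less_iff)
    have *: "int n dvd int m - int p \<longleftrightarrow> m = p" if "m < n" for m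
      using that p(2) by (rule int_dvd_diff_iff)
    have "(\<Sum>k<n. ?d $$ (k, k) * unit_root n (- (int k * int p))) =
        (\<Sum>k<n. \<Sum>m<n. c (int m) * unit_root n (int k * (int m - int p)))"
      by (intro sum.cong) (auto simp: sum_distrib_right right_diff_distrib mult.assoc simp flip: unit_root_add)
    also have "\<dots> = (\<Sum>m<n. c (int m) * (\<Sum>k<n. unit_root n (int k * (int m - int p))))"
      by (subst sum.swap) (simp add: sum_distrib_left)
    also have "\<dots> = (\<Sum>m<n. if m = p then c (int p) * of_nat n else 0)"
      using * by (intro sum.cong) (auto simp: sum_unit_root[OF assms])
    also have "\<dots> = c (int p) * of_nat n"
      using p by simp
    finally show "circulant n c $$ (i, j) =
        circulant n (\<lambda>m. (\<Sum>k<n. ?d $$ (k, k) * unit_root n (- (int k * m))) / of_nat n) $$ (i, j)"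
      unfolding index_circulant[OF ij] p(1)[symmetric] using assms by simp
  qed (auto simp: circulant_def)
qed

lemma conjugate_algebra_eq_circulant:
  assumes "n > 0"
  shows "conjugate_algebra (standard_biunitary n) (diagonal_algebra n) = range (circulant n)"
  unfolding conjugate_algebra_eq
  using conj_by_diagonal_eq_circulant[OF assms] circulant_eq_conj_by_diagonal[OF assms] by blast

section \<open>Relative commutants\<close>

lemma rel_commutant_scalar:
  assumes "A \<subseteq> carrier_mat n n"
  shows "rel_commutant (scalar_algebra n) A = A"
proof -
  have "x * (c \<cdot>\<^sub>m 1\<^sub>m n) = (c \<cdot>\<^sub>m 1\<^sub>m n) * x" if "x \<in> A" for x c
  proof -
    have "x \<in> carrier_mat n n" using assms that by auto
    then show ?thesis
      by (simp add: mult_smult_distrib[of _ n n _ n] mult_smult_assoc_mat[of _ n n _ n])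
  qed
  then show ?thesis by (auto simp: rel_commutant_def scalar_algebra_def)
qed

lemma rel_commutant_diagonal:
  "rel_commutant (diagonal_algebra n) (carrier_mat n n) = diagonal_algebra n"
proof (intro equalityI subsetI)
  fix x assume "x \<in> rel_commutant (diagonal_algebra n) (carrier_mat n n)"
  then have x: "x \<in> carrier_mat n n" and comm: "\<And>b. b \<in> diagonal_algebra n \<Longrightarrow> x * b = b * x"
    by (auto simp: rel_commutant_def)
  \<comment> \<open>One diagonal matrix with pairwise distinct entries suffices: commuting with it
    forces (b_i - b_j) x_ij = 0.\<close>
  let ?b = "mat n n (\<lambda>(i, j). if i = j then of_nat i else 0) :: complex mat"
  have b: "?b \<in> diagonal_algebra n"
    by (auto simp: diagonal_algebra_def diagonal_mat_def)
  have "x $$ (i, j) = 0" if "i < n" "j < n" "i \<noteq> j" for i j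
    using that mult_diagonal_index[OF b x that(1,2)] diagonal_mult_index[OF b x that(1,2)]
    unfolding comm[OF b] by (simp del: index_mult_mat)
  then show "x \<in> diagonal_algebra n"
    using x by (auto simp: diagonal_algebra_def diagonal_mat_def)
next
  fix x assume x: "x \<in> diagonal_algebra n"
  have "x * b = b * x" if b: "b \<in> diagonal_algebra n" for b
  proof (rule eq_matI)
    fix i j assume "i < dim_row (b * x)" "j < dim_col (b * x)"
    then have ij: "i < n" "j < n"
      using x b by (auto simp: diagonal_algebra_def)
    show "(x * b) $$ (i, j) = (b * x) $$ (i, j)"
      unfolding diagonal_mult_index[OF x diagonal_algebra_carrier[OF b] ij]
        diagonal_mult_index[OF b diagonal_algebra_carrier[OF x] ij]
      using ij b x by (cases "i = j") (auto simp: diagonal_algebra_zero)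
  qed (use x b in \<open>auto simp: diagonal_algebra_def\<close>)
  then show "x \<in> rel_commutant (diagonal_algebra n) (carrier_mat n n)"
    using x by (auto simp: rel_commutant_def diagonal_algebra_def)
qed

text \<open>Carries the fact that D is its own commutant over to the circulant matrices.\<close>

lemma rel_commutant_conjugate:
  assumes U: "unitary n U" and A: "A \<subseteq> carrier_mat n n"
  shows "rel_commutant (conjugate_algebra U A) (carrier_mat n n)
    = conjugate_algebra U (rel_commutant A (carrier_mat n n))"
proof (intro equalityI subsetI)
  note V = unitary_adjoint[OF U]
  have inv: "conj_by U (conj_by (mat_adjoint U) x) = x" if "x \<in> carrier_mat n n" for x
    using conj_by_adjoint_conj_by[OF V that] mat_adjoint_adjoint[of U n] U by (simp add: unitary_def)
  fix x assume "x \<in> rel_commutant (conjugate_algebra U A) (carrier_mat n n)"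
  then have x: "x \<in> carrier_mat n n" and comm: "\<And>a. a \<in> A \<Longrightarrow> x * conj_by U a = conj_by U a * x"
    by (auto simp: rel_commutant_def conjugate_algebra_eq)
  have "conj_by (mat_adjoint U) x * a = a * conj_by (mat_adjoint U) x" if "a \<in> A" for a
  proof -
    have a: "a \<in> carrier_mat n n" using that A by auto
    have "conj_by (mat_adjoint U) (x * conj_by U a) = conj_by (mat_adjoint U) (conj_by U a * x)"
      using comm[OF that] by simp
    then show ?thesis
      using a x by (simp add: conj_by_mult[OF V] conj_by_carrier[OF U] conj_by_adjoint_conj_by[OF U])
  qed
  then have "conj_by (mat_adjoint U) x \<in> rel_commutant A (carrier_mat n n)"
    using conj_by_carrier[OF V x] by (auto simp: rel_commutant_def)
  then show "x \<in> conjugate_algebra U (rel_commutant A (carrier_mat n n))"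
    unfolding conjugate_algebra_eq using inv[OF x] by (metis image_eqI)
next
  fix x assume "x \<in> conjugate_algebra U (rel_commutant A (carrier_mat n n))"
  then obtain y where y: "x = conj_by U y" "y \<in> carrier_mat n n" "\<And>a. a \<in> A \<Longrightarrow> y * a = a * y"
    by (auto simp: conjugate_algebra_eq rel_commutant_def)
  have "x * conj_by U a = conj_by U a * x" if "a \<in> A" for a
  proof -
    have "a \<in> carrier_mat n n" using that A by auto
    then show ?thesis
      using y that by (simp flip: conj_by_mult[OF U])
  qed
  then show "x \<in> rel_commutant (conjugate_algebra U A) (carrier_mat n n)"
    using y conj_by_carrier[OF U] by (auto simp: rel_commutant_def conjugate_algebra_eq)
qed

text \<open>Everything commutes with scalars, and D and the circulant algebra are their own
  commutants, so the four commutants are these two algebras in alternation.\<close>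

lemma span_condition_standard_biunitary_iff:
  assumes "n > 0"
  shows "span_condition n (scalar_algebra n) (diagonal_algebra n)
      (conjugate_algebra (standard_biunitary n) (diagonal_algebra n)) (carrier_mat n n) \<longleftrightarrow>
    commutator_span n (diagonal_algebra n) (range (circulant n)) + diagonal_algebra n
      + range (circulant n) + diagonal_algebra n + range (circulant n) = carrier_mat n n"
proof -
  have D: "diagonal_algebra n \<subseteq> carrier_mat n n" and C: "range (circulant n) \<subseteq> carrier_mat n n"
    by (auto simp: diagonal_algebra_def)
  have "rel_commutant (range (circulant n)) (carrier_mat n n) = range (circulant n)"
    using rel_commutant_conjugate[OF unitary_standard_biunitary[OF assms] D]
    unfolding rel_commutant_diagonal conjugate_algebra_eq_circulant[OF assms] .
  then show ?thesis
    unfolding span_condition_def conjugate_algebra_eq_circulant[OF assms]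
      rel_commutant_scalar[OF D] rel_commutant_scalar[OF C] rel_commutant_diagonal by simp
qed

section \<open>Commutators and their span\<close>

lemma index_commutator_diagonal_circulant:
  assumes "d \<in> diagonal_algebra n" "i < n" "j < n"
  shows "(d * circulant n c - circulant n c * d) $$ (i, j) =
    (d $$ (i, i) - d $$ (j, j)) * c ((int i - int j) mod int n)"
proof -
  have "(d * circulant n c - circulant n c * d) $$ (i, j) =
    (d * circulant n c) $$ (i, j) - (circulant n c * d) $$ (i, j)"
    using assms diagonal_algebra_carrier[OF assms(1)] by (subst index_minus_mat) (auto simp: circulant_def)
  then show ?thesis
    unfolding diagonal_mult_index[OF assms(1) circulant_carrier assms(2,3)]
      mult_diagonal_index[OF assms(1) circulant_carrier assms(2,3)] index_circulant[OF assms(2,3)]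
    by (simp add: algebra_simps)
qed

lemma commutators_carrier:
  assumes "V \<subseteq> carrier_mat n n" "W \<subseteq> carrier_mat n n"
  shows "{v * w - w * v | v w. v \<in> V \<and> w \<in> W} \<subseteq> carrier_mat n n"
proof
  fix x assume "x \<in> {v * w - w * v | v w. v \<in> V \<and> w \<in> W}"
  then obtain v w where x: "x = v * w - w * v" and v: "v \<in> carrier_mat n n" and w: "w \<in> carrier_mat n n"
    using assms by blast
  show "x \<in> carrier_mat n n"
    unfolding x by (rule minus_carrier_mat[OF mult_carrier_mat[OF w v]])
qed

text \<open>Minimality of the span: a linear functional needs testing on single commutators only,
  with \<open>N\<close> taken to be its kernel.\<close>

lemma commutator_span_subset:
  assumes N: "N \<subseteq> carrier_mat n n"
    and zero: "0\<^sub>m n n \<in> N" and add: "\<And>x y. x \<in> N \<Longrightarrow> y \<in> N \<Longrightarrow> x + y \<in> N"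
    and smult: "\<And>c x. x \<in> N \<Longrightarrow> c \<cdot>\<^sub>m x \<in> N"
    and comm: "\<And>v w. v \<in> V \<Longrightarrow> w \<in> W \<Longrightarrow> v * w - w * v \<in> N"
  shows "commutator_span n V W \<subseteq> N"
proof -
  interpret M: vectorspace "class_ring :: complex ring" "module_mat TYPE(complex) n n"
    by (rule matrix_vs)
  have "submodule class_ring N (module_mat TYPE(complex) n n)"
    by unfold_locales (use N zero add smult in \<open>auto simp: module_mat_simps\<close>)
  then show ?thesis
    unfolding commutator_span_def using comm by (intro M.span_is_subset) auto
qed

lemma commutator_span_closed:
  assumes VW: "V \<subseteq> carrier_mat n n" "W \<subseteq> carrier_mat n n"
  shows "0\<^sub>m n n \<in> commutator_span n V W"
    and "v \<in> V \<Longrightarrow> w \<in> W \<Longrightarrow> v * w - w * v \<in> commutator_span n V W"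
    and "x \<in> commutator_span n V W \<Longrightarrow> y \<in> commutator_span n V W \<Longrightarrow> x + y \<in> commutator_span n V W"
    and "commutator_span n V W \<subseteq> carrier_mat n n"
proof -
  interpret M: vectorspace "class_ring :: complex ring" "module_mat TYPE(complex) n n"
    by (rule matrix_vs)
  let ?S = "{v * w - w * v | v w. v \<in> V \<and> w \<in> W}"
  have S: "?S \<subseteq> carrier (module_mat TYPE(complex) n n)"
    using commutators_carrier[OF VW] unfolding module_mat_simps .
  interpret N: submodule "class_ring :: complex ring" "M.span ?S" "module_mat TYPE(complex) n n"
    by (rule M.span_is_submodule[OF S])
  show "0\<^sub>m n n \<in> commutator_span n V W"
    using N.zero_closed unfolding commutator_span_def module_mat_simps .
  show "v * w - w * v \<in> commutator_span n V W" if "v \<in> V" "w \<in> W"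
    using M.in_own_span[OF S] that unfolding commutator_span_def by blast
  show "x + y \<in> commutator_span n V W" if "x \<in> commutator_span n V W" "y \<in> commutator_span n V W"
    using N.m_closed that unfolding commutator_span_def module_mat_simps by blast
  show "commutator_span n V W \<subseteq> carrier_mat n n"
    using N.subset unfolding commutator_span_def module_mat_simps .
qed

section \<open>Composite order\<close>

text \<open>The shift by b permutes the residues. Its inverse passes through the integers because j
  - b would truncate.\<close>

lemma sum_add_mod:
  fixes f :: "nat \<Rightarrow> complex"
  assumes "n > 0"
  shows "(\<Sum>j<n. f ((j + b) mod n)) = (\<Sum>j<n. f j)"
proof (rule sum.reindex_bij_witness[of _ "\<lambda>j. nat ((int j - int b) mod int n)" "\<lambda>j. (j + b) mod n"])
  fix j assume "j \<in> {..<n}"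
  then show "nat ((int ((j + b) mod n) - int b) mod int n) = j"
    by (simp add: of_nat_mod mod_diff_left_eq)
next
  fix j assume j: "j \<in> {..<n}"
  have "int ((nat ((int j - int b) mod int n) + b) mod n) = int j"
    using assms j by (simp add: of_nat_mod mod_add_left_eq)
  then show "(nat ((int j - int b) mod int n) + b) mod n = j" by simp
qed (use assms in \<open>auto simp: nat_less_iff\<close>)

text \<open>An unnormalized Fourier coefficient, of frequency \<open>a\<close>, of the b-th cyclic
  subdiagonal. It is used with n = a b.\<close>

definition twisted_diagonal_sum :: "nat \<Rightarrow> nat \<Rightarrow> nat \<Rightarrow> complex mat \<Rightarrow> complex" where
  "twisted_diagonal_sum n a b X = (\<Sum>j<n. unit_root n (int a * int j) * X $$ ((j + b) mod n, j))"

lemma diff_add_mod: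
  fixes b j n :: nat
  assumes "b < n"
  shows "(int ((j + b) mod n) - int j) mod int n = int b"
  using assms by (simp add: of_nat_mod mod_diff_left_eq)

lemma twisted_diagonal_sum_add:
  assumes "X \<in> carrier_mat n n" "Y \<in> carrier_mat n n" "n > 0"
  shows "twisted_diagonal_sum n a b (X + Y) = twisted_diagonal_sum n a b X + twisted_diagonal_sum n a b Y"
  using assms by (simp add: twisted_diagonal_sum_def ring_distribs sum.distrib)

lemma twisted_diagonal_sum_smult:
  assumes "X \<in> carrier_mat n n" "n > 0"
  shows "twisted_diagonal_sum n a b (c \<cdot>\<^sub>m X) = c * twisted_diagonal_sum n a b X"
  using assms by (simp add: twisted_diagonal_sum_def sum_distrib_left mult_ac)

text \<open>As n divides a b, the weight \<epsilon>^(a j) does not change when j is shifted by b.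
  Each summand is therefore c(b) times the difference between the shifted \<open>?f\<close> and
  \<open>?f\<close>, and these differences sum to zero.\<close>

lemma twisted_diagonal_sum_commutator:
  assumes "n > 0" "b < n" "n dvd a * b" "d \<in> diagonal_algebra n"
  shows "twisted_diagonal_sum n a b (d * circulant n c - circulant n c * d) = 0"
proof -
  let ?f = "\<lambda>j. unit_root n (int a * int j) * d $$ (j, j)"
  have rt: "unit_root n (int a * int ((j + b) mod n)) = unit_root n (int a * int j)" for j
  proof (rule unit_root_mod[OF assms(1)])
    have "int a * int b mod int n = 0"
      using assms(3) by (metis dvd_imp_mod_0 of_nat_0 of_nat_mod of_nat_mult)
    then show "int a * int ((j + b) mod n) mod int n = int a * int j mod int n"
      by (simp add: of_nat_mod mod_mult_right_eq ring_distribs) (metis add.right_neutral mod_add_right_eq)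
  qed
  have "twisted_diagonal_sum n a b (d * circulant n c - circulant n c * d)
     = (\<Sum>j<n. c (int b) * (?f ((j + b) mod n) - ?f j))"
    unfolding twisted_diagonal_sum_def
    using assms(1,2) by (intro sum.cong)
      (auto simp: index_commutator_diagonal_circulant[OF assms(4)] diff_add_mod rt algebra_simps
        simp del: index_minus_mat)
  also have "\<dots> = 0"
    unfolding sum_distrib_left[symmetric] sum_subtractf using sum_add_mod[OF assms(1), of ?f] by simp
  finally show ?thesis .
qed

lemma twisted_diagonal_sum_diagonal:
  assumes "d \<in> diagonal_algebra n" "0 < b" "b < n"
  shows "twisted_diagonal_sum n a b d = 0"
proof -
  have "d $$ ((j + b) mod n, j) = 0" if "j < n" for j
  proof -
    have "(j + b) mod n \<noteq> j"
      using diff_add_mod[OF assms(3), of j] assms(2) by auto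
    then show ?thesis using assms that by (intro diagonal_algebra_zero) auto
  qed
  then show ?thesis by (simp add: twisted_diagonal_sum_def)
qed

text \<open>The subdiagonal is constant, which leaves a full sum of a nontrivial character.\<close>

lemma twisted_diagonal_sum_circulant:
  assumes "0 < a" "a < n" "b < n"
  shows "twisted_diagonal_sum n a b (circulant n c) = 0"
proof -
  have "twisted_diagonal_sum n a b (circulant n c) = c (int b) * (\<Sum>j<n. unit_root n (int j * int a))"
    using assms by (simp add: twisted_diagonal_sum_def index_circulant diff_add_mod sum_distrib_left mult_ac)
  then show ?thesis
    using assms by (auto simp: sum_unit_root dest: nat_dvd_not_less)
qed

lemma span_condition_imp_prime:
  assumes "n \<ge> 2"
    and span: "commutator_span n (diagonal_algebra n) (range (circulant n)) + diagonal_algebra n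
      + range (circulant n) + diagonal_algebra n + range (circulant n) = carrier_mat n n"
  shows "prime n"
proof (rule ccontr)
  assume "\<not> prime n"
  then obtain a where a: "a dvd n" "a \<noteq> 1" "a \<noteq> n"
    using assms(1) by (auto simp: prime_nat_iff)
  then obtain b where b: "n = a * b" by blast
  have "a \<noteq> 0" "b \<noteq> 0" "b \<noteq> 1"
    using b a assms(1) by (auto intro: ccontr)
  with a have "1 < a" "1 < b" by auto
  then have ab: "0 < a" "a < n" "0 < b" "b < n"
    unfolding b by auto
  have n: "n > 0" using assms(1) by simp
  let ?\<phi> = "twisted_diagonal_sum n a b"
  let ?S = "commutator_span n (diagonal_algebra n) (range (circulant n))"
  have D: "diagonal_algebra n \<subseteq> carrier_mat n n" and C: "range (circulant n) \<subseteq> carrier_mat n n"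
    by (auto simp: diagonal_algebra_def)
  \<comment> \<open>The whole span lies in the kernel of the functional.\<close>
  have "?S \<subseteq> {x \<in> carrier_mat n n. ?\<phi> x = 0}"
  proof (rule commutator_span_subset)
    fix v w assume "v \<in> diagonal_algebra n" "w \<in> range (circulant n)"
    moreover from this have "v * w - w * v \<in> carrier_mat n n"
      using commutators_carrier[OF D C] by blast
    ultimately show "v * w - w * v \<in> {x \<in> carrier_mat n n. ?\<phi> x = 0}"
      using twisted_diagonal_sum_commutator[of n b a] n ab(4) b by auto
  qed (use n in \<open>auto simp: twisted_diagonal_sum_add twisted_diagonal_sum_smult\<close>,
      simp add: twisted_diagonal_sum_def)
  then have S: "s \<in> carrier_mat n n" "?\<phi> s = 0" if "s \<in> ?S" for s
    using that by auto
  \<comment> \<open>The matrix unit at (b, 0) has functional value \<epsilon>^0 = 1, so it cannot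
    lie in the sum.\<close>
  let ?E = "mat n n (\<lambda>(i, j). if i = b \<and> j = 0 then 1 else 0) :: complex mat"
  have "?E \<in> carrier_mat n n" by simp
  then obtain s d1 c1 d2 c2 where E: "?E = s + d1 + circulant n c1 + d2 + circulant n c2"
    and s: "s \<in> ?S" and d: "d1 \<in> diagonal_algebra n" "d2 \<in> diagonal_algebra n"
    unfolding span[symmetric] by (auto elim!: set_plus_elim)
  have "?\<phi> ?E = 0"
    unfolding E using S[OF s] d[THEN diagonal_algebra_carrier] n
    by (simp add: twisted_diagonal_sum_add twisted_diagonal_sum_circulant[OF ab(1,2,4)]
        twisted_diagonal_sum_diagonal[OF d(1) ab(3,4)] twisted_diagonal_sum_diagonal[OF d(2) ab(3,4)])
  moreover have "?\<phi> ?E = (\<Sum>j<n. if j = 0 then 1 else 0)"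
    unfolding twisted_diagonal_sum_def using n ab by (intro sum.cong) (auto simp: unit_root_def)
  ultimately show False using n by simp
qed

section \<open>Prime order\<close>

text \<open>The walk 0, b, 2b, ... modulo n visits every index once. Partial sums of y along it
  solve the difference equation, and the zero total makes the solution close up.\<close>

lemma cyclic_difference_ex:
  fixes y :: "nat \<Rightarrow> complex"
  assumes "n > 0" "coprime b n" "(\<Sum>j<n. y j) = 0"
  shows "\<exists>d. \<forall>j<n. d ((j + b) mod n) - d j = y j"
proof -
  \<comment> \<open>\<open>f k\<close> is the position after k steps of the walk; its inverse
    \<open>g\<close> below gives the step at which an index is reached.\<close>
  define f where "f k = k * b mod n" for k
  have inj: "inj_on f {..<n}"
  proof (rule inj_onI)
    fix k l assume "k \<in> {..<n}" "l \<in> {..<n}" "f k = f l"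
    then show "k = l"
      using assms(2) by (auto simp: f_def simp flip: cong_def dest!: cong_mult_rcancel_nat[THEN iffD1, rotated]
        intro: cong_less_modulus_unique_nat)
  qed
  have "f ` {..<n} \<subseteq> {..<n}" using assms(1) by (auto simp: f_def)
  then have bij: "bij_betw f {..<n} {..<n}"
    using inj by (simp add: bij_betw_def endo_inj_surj)
  define g where "g = inv_into {..<n} f"
  have g: "g j < n" "f (g j) = j" if "j < n" for j
    using that bij bij_betw_inv_into_right[OF bij, of j] bij_betwE[OF bij_betw_inv_into[OF bij]]
    by (auto simp: g_def)
  have gf: "g (f k) = k" if "k < n" for k
    using that bij_betw_inv_into_left[OF bij, of k] by (simp add: g_def)
  have step: "(j + b) mod n = f (Suc (g j) mod n)" if "j < n" for j
    using g(2)[OF that] by (metis add.commute f_def mod_add_right_eq mod_mult_left_eq mult_Suc)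
  define d where "d j = (\<Sum>l<g j. y (f l))" for j
  have "d ((j + b) mod n) - d j = y j" if j: "j < n" for j
  proof (cases "Suc (g j) < n")
    case True
    then show ?thesis
      unfolding step[OF j] d_def using gf[OF True] g[OF j] by simp
  next
    \<comment> \<open>The last point of the walk: its successor is index 0, where \<open>d\<close>
      is an empty sum, so the total must vanish.\<close>
    case False
    with g(1)[OF j] have n: "n = Suc (g j)" by simp
    have "0 = (\<Sum>l<n. y (f l))"
      using assms(3) sum.reindex_bij_betw[OF bij, of y] by simp
    also have "\<dots> = d j + y j"
      using g(2)[OF j] by (subst n) (simp add: d_def)
    finally have "d j + y j = 0" ..
    moreover have "d ((j + b) mod n) = 0"
      unfolding step[OF j] d_def using gf[of 0] n assms(1) by simp
    ultimately show ?thesis by (simp add: minus_unique)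
  qed
  then show ?thesis by blast
qed

lemma prime_imp_span_condition:
  assumes "prime n"
  shows "commutator_span n (diagonal_algebra n) (range (circulant n)) + diagonal_algebra n
      + range (circulant n) + diagonal_algebra n + range (circulant n) = carrier_mat n n"
    (is "?S + ?D + ?C + ?D + ?C = _")
proof (intro equalityI subsetI)
  have D: "?D \<subseteq> carrier_mat n n" and C: "?C \<subseteq> carrier_mat n n"
    by (auto simp: diagonal_algebra_def)
  note S = commutator_span_closed[OF D C]
  fix X assume "X \<in> ?S + ?D + ?C + ?D + ?C"
  then show "X \<in> carrier_mat n n"
    using S(4) D C by (auto elim!: set_plus_elim)
next
  have D: "?D \<subseteq> carrier_mat n n" and C: "?C \<subseteq> carrier_mat n n"
    by (auto simp: diagonal_algebra_def)
  note S = commutator_span_closed[OF D C]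
  have n: "n > 0" using assms by (simp add: prime_gt_0_nat)
  fix X :: "complex mat" assume X: "X \<in> carrier_mat n n"
  \<comment> \<open>The mean of the m-th cyclic subdiagonal. Subtracting it gives every subdiagonal
    of \<open>R\<close> sum zero, as \<open>cyclic_difference_ex\<close> requires.\<close>
  define c where "c m = (\<Sum>j<n. X $$ ((j + nat m) mod n, j)) / of_nat n" for m
  define R where "R = X - circulant n c"
  have Rc: "R \<in> carrier_mat n n" unfolding R_def by (intro minus_carrier_mat circulant_carrier)
  have R0: "(\<Sum>j<n. R $$ ((j + b) mod n, j)) = 0" if "b < n" for b
  proof -
    have "(\<Sum>j<n. R $$ ((j + b) mod n, j)) = (\<Sum>j<n. X $$ ((j + b) mod n, j) - c (int b))"
      using X n that by (intro sum.cong) (auto simp: R_def circulant_def diff_add_mod)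
    then show ?thesis using n by (simp add: sum_subtractf c_def)
  qed
  \<comment> \<open>The part of \<open>R\<close> on the cyclic subdiagonals 1, ..., m-1, so the
    induction adds one subdiagonal at a time. \<open>M n\<close> omits only the main
    diagonal.\<close>
  define M where "M m = mat n n (\<lambda>(i, j).
    if 0 < (int i - int j) mod int n \<and> (int i - int j) mod int n < int m then R $$ (i, j) else 0)" for m
  have "M m \<in> ?S" if "m \<le> n" for m
    using that
  proof (induction m)
    case 0
    have "M 0 = 0\<^sub>m n n" by (intro eq_matI) (auto simp: M_def)
    then show ?case using S(1) by simp
  next
    case (Suc m)
    show ?case
    proof (cases "m = 0")
      case True
      then have "M (Suc m) = M m" by (intro eq_matI) (auto simp: M_def)
      then show ?thesis using Suc by simp
    next
      case False
      with Suc.prems have m: "0 < m" "m < n" by auto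
      \<comment> \<open>Primality enters here: every nonzero shift generates the residues modulo
        n.\<close>
      then have "coprime m n"
        using assms by (metis coprime_commute nat_dvd_not_less prime_imp_coprime)
      then obtain f where f: "\<And>j. j < n \<Longrightarrow> f ((j + m) mod n) - f j = R $$ ((j + m) mod n, j)"
        using cyclic_difference_ex[OF n _ R0[OF m(2)]] by blast
      define d where "d = mat n n (\<lambda>(i, j). if i = j then f i else 0)"
      \<comment> \<open>The m-th power of the cyclic shift; its commutator with \<open>d\<close> is
        supported on the m-th subdiagonal and reproduces \<open>R\<close> there.\<close>
      define w where "w = circulant n (\<lambda>k. if k = int m then 1 else 0)"
      have d: "d \<in> ?D" by (auto simp: d_def diagonal_algebra_def diagonal_mat_def)
      have w: "w \<in> ?C" by (auto simp: w_def)
      have dw: "d * w - w * d \<in> ?S" by (rule S(2)[OF d w])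
      then have dwc: "d * w - w * d \<in> carrier_mat n n" using S(4) by blast
      have "M (Suc m) = M m + (d * w - w * d)"
      proof (rule eq_matI)
        fix i j assume "i < dim_row (M m + (d * w - w * d))" "j < dim_col (M m + (d * w - w * d))"
        then have ij: "i < n" "j < n" using dwc by auto
        have "i = (j + m) mod n" if "(int i - int j) mod int n = int m"
        proof -
          have "int ((j + m) mod n) = int i"
            using ij by (simp add: of_nat_mod that[symmetric] mod_add_right_eq)
          then show ?thesis by simp
        qed
        then have "(d * w - w * d) $$ (i, j) = (if (int i - int j) mod int n = int m then R $$ (i, j) else 0)"
          using f[OF ij(2)] ij unfolding w_def index_commutator_diagonal_circulant[OF d ij]
          by (auto simp: d_def)
        moreover have "(M m + (d * w - w * d)) $$ (i, j) = M m $$ (i, j) + (d * w - w * d) $$ (i, j)"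
          using ij dwc by (subst index_add_mat) auto
        ultimately show "M (Suc m) $$ (i, j) = (M m + (d * w - w * d)) $$ (i, j)"
          using ij m by (auto simp: M_def simp del: index_add_mat index_minus_mat)
      qed (use dwc in \<open>auto simp: M_def\<close>)
      then show ?thesis using S(3)[OF _ dw] Suc by simp
    qed
  qed
  then have MS: "M n \<in> ?S" by simp
  have dR: "diag_part n R \<in> ?D"
    by (auto simp: diag_part_def diagonal_algebra_def diagonal_mat_def)
  \<comment> \<open>Zero matrices fill the second occurrences of D and of the circulant algebra in
    the sum.\<close>
  have z: "0\<^sub>m n n \<in> ?D" "0\<^sub>m n n \<in> ?C"
    by (auto simp: diagonal_algebra_def diagonal_mat_def circulant_def intro!: image_eqI[of _ _ "\<lambda>_. 0"] eq_matI)
  have "X = M n + diag_part n R + circulant n c + 0\<^sub>m n n + 0\<^sub>m n n"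
  proof (rule eq_matI)
    fix i j assume "i < dim_row (M n + diag_part n R + circulant n c + 0\<^sub>m n n + 0\<^sub>m n n)"
      "j < dim_col (M n + diag_part n R + circulant n c + 0\<^sub>m n n + 0\<^sub>m n n)"
    then have ij: "i < n" "j < n" by (auto simp: circulant_def)
    have "(int i - int j) mod int n \<noteq> 0" if "i \<noteq> j"
      using ij that by (simp add: mod_eq_0_iff_dvd int_dvd_diff_iff)
    then have "0 < (int i - int j) mod int n" if "i \<noteq> j"
      using n that pos_mod_sign[of "int n" "int i - int j"] by linarith
    moreover have "(int i - int j) mod int n < int n"
      using n by simp
    ultimately have "M n $$ (i, j) + diag_part n R $$ (i, j) = R $$ (i, j)"
      using ij by (auto simp: M_def diag_part_def)
    moreover have "X $$ (i, j) = R $$ (i, j) + circulant n c $$ (i, j)"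
      using X ij by (simp add: R_def circulant_def)
    ultimately show "X $$ (i, j) = (M n + diag_part n R + circulant n c + 0\<^sub>m n n + 0\<^sub>m n n) $$ (i, j)"
      using ij by (simp add: M_def diag_part_def circulant_def)
  qed (use X in \<open>auto simp: circulant_def\<close>)
  moreover have "M n + diag_part n R + circulant n c + 0\<^sub>m n n + 0\<^sub>m n n \<in> ?S + ?D + ?C + ?D + ?C"
    by (intro set_plus_intro MS dR z rangeI)
  ultimately show "X \<in> ?S + ?D + ?C + ?D + ?C" by (rule ssubst)
qed

theorem mainTheorem3:
  fixes n :: nat
  assumes "n \<ge> 2"
  shows "commuting_square n (normalized_trace n)
           (scalar_algebra n) (diagonal_algebra n)
           (conjugate_algebra (standard_biunitary n) (diagonal_algebra n)) (carrier_mat n n)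
         \<and> (span_condition n
              (scalar_algebra n) (diagonal_algebra n)
              (conjugate_algebra (standard_biunitary n) (diagonal_algebra n)) (carrier_mat n n)
            \<longleftrightarrow> prime n)"
proof -
  have n: "n > 0" using assms by simp
  show ?thesis
    unfolding span_condition_standard_biunitary_iff[OF n]
    using commuting_square_standard_biunitary[OF n] span_condition_imp_prime[OF assms]
      prime_imp_span_condition by blast
qed

end
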